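(* Let $F=(F_1,\dots,F_m):\mathbb{R}^n\to\mathbb{R}^m$ be continuously differentiable. Let $\{x^k\}_{k\ge0}$ be an infinite sequence of non-critical points generated by the BBDMO\_VM algorithm with matrices $\{B_k\}$, and suppose there exist constants $a,b>0$ with $aI\preceq B_k\preceq bI$ for all $k$. Assume that for every $k\ge 0$ and every $i\in[m]$ the function $F_i$ is $L_i^k$-smooth and $\mu_i^k$-strongly convex relative to $\|\cdot\|_{B_k}$, where $\mu_i^k\ge\delta_i>0$ for constants $\delta_1,\dots,\delta_m$ independent of $k$. Then: (i) $\{x^k\}$ converges to some Pareto solution $x^*$ of $\min_{x\in\mathbb{R}^n}F(x)$. (ii) For every $k\ge0$, $$u_0^{\delta}(x^{k+1})\le\left(1-2\gamma\sigma(1-\sigma)\min_{i\in[m]}\left\{\frac{\mu_i^k\delta_i^2}{(L_i^k)^3}\right\}\right)u_0^{\delta}(x^k),$$ where $u_0^{\delta}(x):=\sup_{y\in\mathbb{R}^n}\min_{i\in[m]}\left\{\frac{F_i(x)-F_i(y)}{\delta_i}\right\}$.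
   Context: Notation: $[m]=\{1,\dots,m\}$; $\|x\|_B=\sqrt{\langle x,Bx\rangle}$ for a symmetric positive definite matrix $B$; for symmetric matrices $U\preceq V$ means $V-U$ is positive semidefinite. A differentiable $h:\mathbb{R}^n\to\mathbb{R}$ is $L$-smooth relative to $\|\cdot\|_B$ if $h(y)\le h(x)+\langle\nabla h(x),y-x\rangle+\frac L2\|y-x\|_B^2$ for all $x,y\in\mathbb{R}^n$, and $\mu$-strongly convex relative to $\|\cdot\|_B$ if $h(y)\ge h(x)+\langle\nabla h(x),y-x\rangle+\frac\mu2\|y-x\|_B^2$ for all $x,y\in\mathbb{R}^n$. A point $x^*$ is a Pareto solution if there is no $x\in\mathbb{R}^n$ with $F_i(x)\le F_i(x^* )$ for all $i\in[m]$ and $F(x)\ne F(x^* )$. A point $x$ is Pareto critical if there is no $d\in\mathbb{R}^n$ with $\langle\nabla F_i(x),d\rangle<0$ for all $i\in[m]$; otherwise it is non-critical. BBDMO\_VM algorithm (Barzilai-Borwein descent method with variable metrics). Parameters: $0<\alpha_{\min}\le\alpha_{\max}$, $\sigma,\gamma\in(0,1)$. Data: $x^0\in\mathbb{R}^n$, a point $x^{-1}\neq x^0$ near $x^0$, and symmetric positive definite matrices $B_0,B_1,\dots$ ($B_{k+1}$ being chosen, by any rule, at the end of iteration $k$). For $k=0,1,2,\dots$: 1. With $s^{k-1}=x^k-x^{k-1}$ and $y_i^{k-1}=\nabla F_i(x^k)-\nabla F_i(x^{k-1})$, set for each $i\in[m]$: $\alpha_i^k=\max\{\alpha_{\min},\min\{\langle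 s^{k-1},y_i^{k-1}\rangle/\|s^{k-1}\|_{B_k}^2,\ \alpha_{\max}\}\}$ if $\langle s^{k-1},y_i^{k-1}\rangle>0$; $\alpha_i^k=\max\{\alpha_{\min},\min\{\|y_i^{k-1}\|/\|B_ks^{k-1}\|,\ \alpha_{\max}\}\}$ if $\langle s^{k-1},y_i^{k-1}\rangle<0$; $\alpha_i^k=\alpha_{\min}$ if $\langle s^{k-1},y_i^{k-1}\rangle=0$. 2. Let $d^k$ be the unique minimizer over $d\in\mathbb{R}^n$ of $\max_{i\in[m]}\left\{\frac{\langle\nabla F_i(x^k),d\rangle}{\alpha_i^k}+\frac12\|d\|_{B_k}^2\right\}$. 3. If $d^k=0$, stop and return $x^k$. Otherwise let $t_k$ be the largest element of $\{1,\gamma,\gamma^2,\dots\}$ such that $F_i(x^k+t_kd^k)-F_i(x^k)\le t_k\sigma\langle\nabla F_i(x^k),d^k\rangle$ for all $i\in[m]$ (Armijo backtracking), and set $x^{k+1}=x^k+t_kd^k$. Standing convention: $\alpha_{\min}$ is sufficiently small and $\alpha_{\max}$ sufficiently large, meaning $\alpha_{\min}\le L_i^k$ and $\alpha_{\max}\ge\mu_i^k$ for all $i\in[m]$ and $k\ge0$ (so that $\mu_i^k\le\alpha_i^k\le L_i^k$). *)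

theory Defs
  imports "HOL-Analysis.Analysis"
begin

(* Meaningful only where h is differentiable. *)
definition grad :: "(real^'n \<Rightarrow> real) \<Rightarrow> real^'n \<Rightarrow> real^'n" where
  "grad h x = (THE D. GDERIV h x :> D)"

lemma grad_eqI:
  assumes "GDERIV h x :> D"
  shows "grad h x = D"
  unfolding grad_def
proof (rule the_equality)
  fix D' assume "GDERIV h x :> D'"
  then have "(\<lambda>u. u \<bullet> D') = (\<lambda>u. u \<bullet> D)"
    using assms unfolding gderiv_def by (rule has_derivative_unique)
  then show "D' = D"
    by (simp add: fun_eq_iff vector_eq_ldot)
qed (fact assms)

definition continuously_differentiable :: "(real^'n \<Rightarrow> real^'m) \<Rightarrow> bool" where
  "continuously_differentiable F \<longleftrightarrow>
     (\<exists>F' :: real^'n \<Rightarrow> (real^'n) \<Rightarrow>\<^sub>L (real^'m).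
        (\<forall>x. (F has_derivative blinfun_apply (F' x)) (at x)) \<and> continuous_on UNIV F')"

definition pos_semidefinite :: "real^'n^'n \<Rightarrow> bool" where
  "pos_semidefinite A \<longleftrightarrow> transpose A = A \<and> (\<forall>v. 0 \<le> v \<bullet> (A *v v))"

definition pos_definite :: "real^'n^'n \<Rightarrow> bool" where
  "pos_definite A \<longleftrightarrow> transpose A = A \<and> (\<forall>v. v \<noteq> 0 \<longrightarrow> 0 < v \<bullet> (A *v v))"

definition loewner_le :: "real^'n^'n \<Rightarrow> real^'n^'n \<Rightarrow> bool" (infix "\<preceq>\<^sub>L" 50) where
  "U \<preceq>\<^sub>L V \<longleftrightarrow> pos_semidefinite (V - U)"

definition norm_wrt :: "real^'n^'n \<Rightarrow> real^'n \<Rightarrow> real" where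
  "norm_wrt B v = sqrt (v \<bullet> (B *v v))"

definition smooth_relative :: "real \<Rightarrow> real^'n^'n \<Rightarrow> (real^'n \<Rightarrow> real) \<Rightarrow> bool" where
  "smooth_relative L B h \<longleftrightarrow> (\<forall>x. h differentiable (at x)) \<and>
     (\<forall>x y. h y \<le> h x + grad h x \<bullet> (y - x) + L / 2 * (norm_wrt B (y - x))\<^sup>2)"

definition strongly_convex_relative :: "real \<Rightarrow> real^'n^'n \<Rightarrow> (real^'n \<Rightarrow> real) \<Rightarrow> bool" where
  "strongly_convex_relative \<mu> B h \<longleftrightarrow> (\<forall>x. h differentiable (at x)) \<and>
     (\<forall>x y. h y \<ge> h x + grad h x \<bullet> (y - x) + \<mu> / 2 * (norm_wrt B (y - x))\<^sup>2)"

definition pareto_solution :: "(real^'n \<Rightarrow> real^'m) \<Rightarrow> real^'n \<Rightarrow> bool" where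
  "pareto_solution F xs \<longleftrightarrow> \<not> (\<exists>x. (\<forall>i. F x $ i \<le> F xs $ i) \<and> F x \<noteq> F xs)"

definition pareto_critical :: "(real^'n \<Rightarrow> real^'m) \<Rightarrow> real^'n \<Rightarrow> bool" where
  "pareto_critical F x \<longleftrightarrow> \<not> (\<exists>d. \<forall>i. grad (\<lambda>z. F z $ i) x \<bullet> d < 0)"

definition bb_coeff :: "real \<Rightarrow> real \<Rightarrow> real^'n^'n \<Rightarrow> real^'n \<Rightarrow> real^'n \<Rightarrow> real" where
  "bb_coeff \<alpha>min \<alpha>max B s y =
     (if s \<bullet> y > 0 then max \<alpha>min (min (s \<bullet> y / (norm_wrt B s)\<^sup>2) \<alpha>max)
      else if s \<bullet> y < 0 then max \<alpha>min (min (norm y / norm (B *v s)) \<alpha>max)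
      else \<alpha>min)"

definition direction_objective ::
  "(real^'n \<Rightarrow> real^'m) \<Rightarrow> real^'n^'n \<Rightarrow> ('m \<Rightarrow> real) \<Rightarrow> real^'n \<Rightarrow> real^'n \<Rightarrow> real" where
  "direction_objective F B \<alpha> x d =
     (MAX i. (grad (\<lambda>z. F z $ i) x \<bullet> d) / \<alpha> i + 1 / 2 * (norm_wrt B d)\<^sup>2)"

definition armijo :: "(real^'n \<Rightarrow> real^'m) \<Rightarrow> real \<Rightarrow> real^'n \<Rightarrow> real^'n \<Rightarrow> real \<Rightarrow> bool" where
  "armijo F \<sigma> x d t \<longleftrightarrow>
     (\<forall>i. F (x + t *\<^sub>R d) $ i - F x $ i \<le> t * \<sigma> * (grad (\<lambda>z. F z $ i) x \<bullet> d))"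

definition backtracking_step ::
  "(real^'n \<Rightarrow> real^'m) \<Rightarrow> real \<Rightarrow> real \<Rightarrow> real^'n \<Rightarrow> real^'n \<Rightarrow> real \<Rightarrow> bool" where
  "backtracking_step F \<sigma> \<gamma> x d t \<longleftrightarrow>
     t \<in> range (\<lambda>j::nat. \<gamma> ^ j) \<and> armijo F \<sigma> x d t \<and>
     (\<forall>t' \<in> range (\<lambda>j::nat. \<gamma> ^ j). armijo F \<sigma> x d t' \<longrightarrow> t' \<le> t)"

(* One non-terminating iteration leading from the current point x (with predecessor xp) to x'.
   The direction objective is strictly convex for positive definite B, so its minimizer d is
   unique. *)
definition bbdmo_vm_step ::
  "(real^'n \<Rightarrow> real^'m) \<Rightarrow> real \<Rightarrow> real \<Rightarrow> real \<Rightarrow> real \<Rightarrow> real^'n^'n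
     \<Rightarrow> real^'n \<Rightarrow> real^'n \<Rightarrow> real^'n \<Rightarrow> bool" where
  "bbdmo_vm_step F \<alpha>min \<alpha>max \<sigma> \<gamma> B xp x x' \<longleftrightarrow>
     (\<exists>\<alpha> d t.
        (\<forall>i. \<alpha> i = bb_coeff \<alpha>min \<alpha>max B (x - xp)
                      (grad (\<lambda>z. F z $ i) x - grad (\<lambda>z. F z $ i) xp)) \<and>
        is_arg_min (direction_objective F B \<alpha> x) (\<lambda>_. True) d \<and>
        d \<noteq> 0 \<and>
        backtracking_step F \<sigma> \<gamma> x d t \<and>
        x' = x + t *\<^sub>R d)"

(* An infinite run; xm is the auxiliary starting point with index -1. *)
definition bbdmo_vm_sequence ::
  "(real^'n \<Rightarrow> real^'m) \<Rightarrow> real \<Rightarrow> real \<Rightarrow> real \<Rightarrow> real \<Rightarrow> (nat \<Rightarrow> real^'n^'n)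
     \<Rightarrow> real^'n \<Rightarrow> (nat \<Rightarrow> real^'n) \<Rightarrow> bool" where
  "bbdmo_vm_sequence F \<alpha>min \<alpha>max \<sigma> \<gamma> B xm x \<longleftrightarrow>
     xm \<noteq> x 0 \<and>
     (\<forall>k. pos_definite (B k)) \<and>
     (\<forall>k. bbdmo_vm_step F \<alpha>min \<alpha>max \<sigma> \<gamma> (B k)
            (case k of 0 \<Rightarrow> xm | Suc j \<Rightarrow> x j) (x k) (x (Suc k)))"

(* The merit function u_0^delta; extended-real valued since the supremum may be infinite for
   general F. *)
definition u0 :: "('m \<Rightarrow> real) \<Rightarrow> (real^'n \<Rightarrow> real^'m) \<Rightarrow> real^'n \<Rightarrow> ereal" where
  "u0 \<delta> F x = (SUP y. ereal (MIN i. (F x $ i - F y $ i) / \<delta> i))"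

end

theory Submission
  imports Defs
begin

text \<open>
  By separation, the direction satisfies \<open>B d = - (\<Sum>i. \<eta> i * g i / \<alpha> i)\<close> for some \<open>\<eta>\<close> in the
  simplex, where \<open>g i\<close> is the gradient of the \<open>i\<close>-th objective. With
  \<open>S = (\<Sum>i. \<eta> i * \<delta> i / \<alpha> i)\<close> and \<open>M = (\<Sum>i. \<eta> i * \<mu> i / \<alpha> i)\<close>, strong convexity gives
  \<open>u0 x \<le> \<parallel>d\<parallel>\<^sup>2 / (2 * S * M)\<close> in the \<open>B\<close>-norm, while the Armijo condition lowers every
  \<open>F i / \<delta> i\<close>, hence \<open>u0\<close>, by at least \<open>\<sigma> * t * \<parallel>d\<parallel>\<^sup>2\<close>. A backtracked step satisfies
  \<open>t \<ge> 2 * \<gamma> * (1 - \<sigma>) * \<alpha> j / L j\<close> for some \<open>j\<close>, an index unrelated to those where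
  \<open>\<delta> i / \<alpha> i\<close> and \<open>\<mu> i / \<alpha> i\<close> are small. The single minimum
  \<open>c = (MIN i. \<mu> i * (\<delta> i)\<^sup>2 / (L i)^3)\<close> is recovered from \<open>c \<le> M * S\<^sup>2\<close> (AM-GM and averaging
  over \<open>\<eta>\<close>) and \<open>c \<le> (\<alpha> j / L j)^3\<close>, using the first bound if \<open>S \<le> 2 * \<alpha> j / L j\<close> and the
  second otherwise.

  With uniform constants, \<open>u0\<close> decays geometrically and dominates the squared step lengths, so the
  iterates converge; \<open>u0\<close> vanishes at the limit, which by strict convexity is a Pareto solution.
\<close>

section \<open>Norms induced by positive definite matrices\<close>

lemma norm_wrt_power2:
  assumes "pos_definite B"
  shows "(norm_wrt B v)\<^sup>2 = v \<bullet> (B *v v)"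
proof -
  have "0 \<le> v \<bullet> (B *v v)"
    using assms unfolding pos_definite_def by (cases "v = 0") (auto intro: less_imp_le)
  then show ?thesis by (simp add: norm_wrt_def)
qed

lemma pos_definite_sym:
  assumes "pos_definite B"
  shows "(B *v u) \<bullet> v = u \<bullet> (B *v v)"
  using assms unfolding pos_definite_def by (metis dot_lmul_matrix transpose_matrix_vector)

lemma norm_wrt_bounds:
  assumes "pos_definite B" and "(a *\<^sub>R mat 1) \<preceq>\<^sub>L B" and "B \<preceq>\<^sub>L (b *\<^sub>R mat 1)"
  shows "a * (norm v)\<^sup>2 \<le> (norm_wrt B v)\<^sup>2" and "(norm_wrt B v)\<^sup>2 \<le> b * (norm v)\<^sup>2"
  using assms(2,3) unfolding norm_wrt_power2[OF assms(1)] loewner_le_def pos_semidefinite_def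
  by (simp_all add: matrix_vector_mult_diff_rdistrib scaleR_matrix_vector_assoc[symmetric]
      inner_diff_right power2_norm_eq_inner)

lemma norm_wrt_scaleR_power2:
  assumes "pos_definite B"
  shows "(norm_wrt B (s *\<^sub>R v))\<^sup>2 = s\<^sup>2 * (norm_wrt B v)\<^sup>2"
  unfolding norm_wrt_power2[OF assms] by (simp add: power2_eq_square matrix_vector_mult_scaleR)

lemma norm_wrt_add_power2:
  assumes "pos_definite B"
  shows "(norm_wrt B (u + v))\<^sup>2 = (norm_wrt B u)\<^sup>2 + 2 * ((B *v u) \<bullet> v) + (norm_wrt B v)\<^sup>2"
  unfolding norm_wrt_power2[OF assms]
  by (simp add: matrix_vector_right_distrib inner_add_left inner_add_right
      pos_definite_sym[OF assms] inner_commute[of v "B *v u"])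

lemma norm_wrt_minus:
  shows "norm_wrt B (u - v) = norm_wrt B (v - u)"
  unfolding norm_wrt_def
  by (simp add: matrix_vector_mult_diff_distrib inner_diff_left inner_diff_right)

section \<open>Curvature along a step and the Barzilai-Borwein coefficients\<close>

lemma strongly_convex_relative_monotone:
  assumes "strongly_convex_relative \<mu> B h"
  shows "\<mu> * (norm_wrt B (y - x))\<^sup>2 \<le> (y - x) \<bullet> (grad h y - grad h x)"
proof -
  have "h y \<ge> h x + grad h x \<bullet> (y - x) + \<mu> / 2 * (norm_wrt B (y - x))\<^sup>2"
    "h x \<ge> h y + grad h y \<bullet> (x - y) + \<mu> / 2 * (norm_wrt B (y - x))\<^sup>2"
    using assms norm_wrt_minus[of B x y] unfolding strongly_convex_relative_def by metis+
  then show ?thesis by (simp add: algebra_simps inner_commute)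
qed

lemma smooth_relative_monotone:
  assumes "smooth_relative L B h"
  shows "(y - x) \<bullet> (grad h y - grad h x) \<le> L * (norm_wrt B (y - x))\<^sup>2"
proof -
  have "h y \<le> h x + grad h x \<bullet> (y - x) + L / 2 * (norm_wrt B (y - x))\<^sup>2"
    "h x \<le> h y + grad h y \<bullet> (x - y) + L / 2 * (norm_wrt B (y - x))\<^sup>2"
    using assms norm_wrt_minus[of B x y] unfolding smooth_relative_def by metis+
  then show ?thesis by (simp add: algebra_simps inner_commute)
qed

text \<open>Strong convexity makes the curvature \<open>?p\<close> positive, so only the first case
  of \<open>bb_coeff\<close> occurs. The quotient \<open>?p / ?n\<close> lies between \<mu> and L,
  and truncation keeps it there because \<open>\<alpha>min \<le> L\<close> and
  \<open>\<mu> \<le> \<alpha>max\<close>.\<close>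

lemma bb_coeff_bounds:
  assumes B: "pos_definite B" and "x \<noteq> y"
    and sc: "strongly_convex_relative \<mu> B h" and sm: "smooth_relative L B h"
    and "0 < \<mu>" "\<alpha>min \<le> L" "\<mu> \<le> \<alpha>max"
  shows "\<mu> \<le> bb_coeff \<alpha>min \<alpha>max B (x - y) (grad h x - grad h y)"
    and "bb_coeff \<alpha>min \<alpha>max B (x - y) (grad h x - grad h y) \<le> L"
proof -
  let ?p = "(x - y) \<bullet> (grad h x - grad h y)" and ?n = "(norm_wrt B (x - y))\<^sup>2"
  have n: "0 < ?n"
    using B \<open>x \<noteq> y\<close> unfolding norm_wrt_power2[OF B] pos_definite_def by simp
  have lo: "\<mu> * ?n \<le> ?p" and hi: "?p \<le> L * ?n"
    using strongly_convex_relative_monotone[OF sc] smooth_relative_monotone[OF sm] by auto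
  have "0 < ?p" using lo n \<open>0 < \<mu>\<close> by (smt (verit) mult_pos_pos)
  moreover have "\<mu> \<le> ?p / ?n" "?p / ?n \<le> L"
    using lo hi n by (simp_all add: field_simps)
  ultimately show "\<mu> \<le> bb_coeff \<alpha>min \<alpha>max B (x - y) (grad h x - grad h y)"
    "bb_coeff \<alpha>min \<alpha>max B (x - y) (grad h x - grad h y) \<le> L"
    using assms(6,7) unfolding bb_coeff_def by auto
qed

section \<open>Optimality conditions of the direction subproblem\<close>

lemma argmin_max_inner_le:
  fixes h :: "'m::finite \<Rightarrow> real^'n"
  assumes B: "pos_definite B"
    and d: "\<And>e. (MAX i. h i \<bullet> d + 1 / 2 * (norm_wrt B d)\<^sup>2) \<le> (MAX i. h i \<bullet> e + 1 / 2 * (norm_wrt B e)\<^sup>2)"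
  shows "h i \<bullet> d \<le> - (norm_wrt B d)\<^sup>2"
proof -
  let ?q = "(norm_wrt B d)\<^sup>2" and ?p = "MAX i. h i \<bullet> d"
  have shift: "(MAX i. f i + c) = (MAX i. f i) + c" for f :: "'m \<Rightarrow> real" and c
    using Max_add_commute[of UNIV f c] by simp
  \<comment> \<open>Shrinking \<open>d\<close> to \<open>(1 - \<epsilon>) *\<^sub>R d\<close> cannot
    lower the objective, and the nonnegative factor passes through the maximum. Dividing by
    \<epsilon> gives this inequality; letting \<epsilon> tend to 0 leaves
    \<open>?p + ?q \<le> 0\<close>.\<close>
  have "?p + ?q - \<epsilon> / 2 * ?q \<le> 0" if "0 < \<epsilon>" "\<epsilon> < 1" for \<epsilon>
  proof -
    have "(MAX i. h i \<bullet> ((1 - \<epsilon>) *\<^sub>R d)) = (1 - \<epsilon>) * ?p"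
    proof -
      have "mono (\<lambda>r. (1 - \<epsilon>) * r)" using that by (auto intro!: monoI mult_left_mono)
      from mono_Max_commute[OF this, of "range (\<lambda>i. h i \<bullet> d)"] show ?thesis
        by (simp add: image_image)
    qed
    then have "?p + 1 / 2 * ?q \<le> (1 - \<epsilon>) * ?p + 1 / 2 * ((1 - \<epsilon>)\<^sup>2 * ?q)"
      using d[of "(1 - \<epsilon>) *\<^sub>R d"] by (simp only: shift norm_wrt_scaleR_power2[OF B])
    then have "\<epsilon> * (?p + ?q - \<epsilon> / 2 * ?q) \<le> 0" by (simp add: power2_eq_square field_simps)
    with that show ?thesis by (simp add: mult_le_0_iff)
  qed
  then have ev: "eventually (\<lambda>\<epsilon>. ?p + ?q - \<epsilon> / 2 * ?q \<le> 0) (at_right 0)"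
    by (intro eventually_at_rightI[of 0 1]) auto
  have "((\<lambda>\<epsilon>. ?p + ?q - \<epsilon> / 2 * ?q) \<longlongrightarrow> ?p + ?q - 0 / 2 * ?q) (at_right 0)"
    by (intro tendsto_intros) auto
  from tendsto_upperbound[OF this ev] have "?p + ?q \<le> 0" by simp
  moreover have "h i \<bullet> d \<le> ?p" by simp
  ultimately show ?thesis by linarith
qed

text \<open>The KKT multipliers come from separation. If \<open>- (B *v d)\<close> were outside the
  convex hull of the \<open>h i\<close>, a separating vector \<open>e\<close> would yield a point
  \<open>d - \<tau> *\<^sub>R e\<close> at which every piece of the maximum is strictly smaller than
  at \<open>d\<close>.\<close>

lemma argmin_max_multipliers:
  fixes h :: "'m::finite \<Rightarrow> real^'n"
  assumes B: "pos_definite B"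
    and d: "\<And>e. (MAX i. h i \<bullet> d + 1 / 2 * (norm_wrt B d)\<^sup>2) \<le> (MAX i. h i \<bullet> e + 1 / 2 * (norm_wrt B e)\<^sup>2)"
  obtains \<eta> :: "'m \<Rightarrow> real" where "\<And>i. 0 \<le> \<eta> i" "(\<Sum>i\<in>UNIV. \<eta> i) = 1"
    "B *v d = - (\<Sum>i\<in>UNIV. \<eta> i *\<^sub>R h i)"
proof -
  let ?S = "{\<eta> :: real^'m. (\<forall>i. 0 \<le> \<eta> $ i) \<and> (\<Sum>i\<in>UNIV. \<eta> $ i) = 1}"
  let ?f = "\<lambda>\<eta> :: real^'m. \<Sum>i\<in>UNIV. \<eta> $ i *\<^sub>R h i"
  have lin: "linear ?f"
    by (rule linearI) (simp_all add: scaleR_left_distrib sum.distrib scaleR_sum_right)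
  have "closed ?S"
    by (intro closed_Collect_conj closed_Collect_all closed_Collect_le closed_Collect_eq continuous_intros)
  moreover have "norm \<eta> \<le> 1" if "\<eta> \<in> ?S" for \<eta>
    using norm_le_l1_cart[of \<eta>] that by simp
  then have "bounded ?S" by (auto simp: bounded_iff)
  ultimately have "compact ?S" by (simp add: compact_eq_bounded_closed)
  \<comment> \<open>The convex hull of the \<open>h i\<close> is the linear image of the simplex
    \<open>?S\<close>, so compactness of \<open>?S\<close> makes it closed, as separation
    requires.\<close>
  then have "closed (?f ` ?S)"
    using lin by (intro compact_imp_closed compact_continuous_image)
      (auto simp: linear_conv_bounded_linear intro: linear_continuous_on)
  have "convex ?S"
    by (auto simp: convex_def sum.distrib simp flip: sum_distrib_left)
  then have conv: "convex (?f ` ?S)" by (rule convex_linear_image[OF lin])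
  have "- (B *v d) \<in> ?f ` ?S"
  proof (rule ccontr)
    assume "- (B *v d) \<notin> ?f ` ?S"
    from separating_hyperplane_closed_point[OF conv \<open>closed (?f ` ?S)\<close> this]
    obtain e \<beta> where e: "e \<bullet> - (B *v d) < \<beta>" "\<forall>z\<in>?f ` ?S. \<beta> < e \<bullet> z" by blast
    have hi: "\<beta> < e \<bullet> h i" for i
    proof -
      have "?f (axis i 1) = h i"
        by (simp add: axis_def if_distrib[of "\<lambda>r. r *\<^sub>R _"] cong: if_cong)
      moreover have "axis i 1 \<in> ?S" by (simp add: axis_def)
      then have "\<beta> < e \<bullet> ?f (axis i 1)" by (rule e(2)[THEN bspec, OF imageI])
      ultimately show ?thesis by simp
    qed
    \<comment> \<open>\<kappa> is the separation gap: every
      \<open>h i \<bullet> e + e \<bullet> (B *v d)\<close> exceeds it.\<close>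
    define \<kappa> where "\<kappa> = \<beta> + e \<bullet> (B *v d)"
    have "0 < \<kappa>" using e(1) by (simp add: \<kappa>_def)
    let ?Q = "(norm_wrt B e)\<^sup>2"
    \<comment> \<open>With this \<tau> the quadratic term \<open>\<tau>\<^sup>2 * ?Q / 2\<close> is
      at most half of the linear gain \<open>\<tau> * \<kappa>\<close>. The summand 1 keeps the
      denominator positive.\<close>
    define \<tau> where "\<tau> = \<kappa> / (?Q + 1)"
    have \<tau>: "0 < \<tau>" "\<tau> * ?Q \<le> \<kappa>"
      using \<open>0 < \<kappa>\<close> by (simp_all add: \<tau>_def field_simps add_pos_nonneg)
    have lt: "h i \<bullet> (d - \<tau> *\<^sub>R e) + 1 / 2 * (norm_wrt B (d - \<tau> *\<^sub>R e))\<^sup>2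
        < h i \<bullet> d + 1 / 2 * (norm_wrt B d)\<^sup>2" for i
    proof -
      have "(norm_wrt B (d - \<tau> *\<^sub>R e))\<^sup>2 = (norm_wrt B d)\<^sup>2 - 2 * \<tau> * (e \<bullet> (B *v d)) + \<tau>\<^sup>2 * ?Q"
        using norm_wrt_add_power2[OF B, of d "(- \<tau>) *\<^sub>R e"]
          norm_wrt_scaleR_power2[OF B, of "- \<tau>" e] by (simp add: inner_commute)
      moreover have "\<tau> * (h i \<bullet> e + e \<bullet> (B *v d)) > \<tau> * \<kappa>"
        using hi[of i] \<tau>(1) by (simp add: \<kappa>_def inner_commute)
      moreover have "\<tau> * (\<tau> * ?Q) \<le> \<tau> * \<kappa>" using \<tau> by (intro mult_left_mono) auto
      moreover have "0 < \<tau> * \<kappa>" using \<tau> \<open>0 < \<kappa>\<close> by simp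
      ultimately show ?thesis by (simp add: inner_diff_right power2_eq_square algebra_simps)
    qed
    have "(MAX i. h i \<bullet> (d - \<tau> *\<^sub>R e) + 1 / 2 * (norm_wrt B (d - \<tau> *\<^sub>R e))\<^sup>2)
        \<in> range (\<lambda>i. h i \<bullet> (d - \<tau> *\<^sub>R e) + 1 / 2 * (norm_wrt B (d - \<tau> *\<^sub>R e))\<^sup>2)"
      by (rule Max_in) auto
    then obtain i where i: "(MAX i. h i \<bullet> (d - \<tau> *\<^sub>R e) + 1 / 2 * (norm_wrt B (d - \<tau> *\<^sub>R e))\<^sup>2)
        = h i \<bullet> (d - \<tau> *\<^sub>R e) + 1 / 2 * (norm_wrt B (d - \<tau> *\<^sub>R e))\<^sup>2"
      by (elim imageE)
    have "(MAX i. h i \<bullet> (d - \<tau> *\<^sub>R e) + 1 / 2 * (norm_wrt B (d - \<tau> *\<^sub>R e))\<^sup>2)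
        < (MAX i. h i \<bullet> d + 1 / 2 * (norm_wrt B d)\<^sup>2)"
      unfolding i by (rule less_le_trans[OF lt[of i]], rule Max_ge) auto
    with leD[OF d[of "d - \<tau> *\<^sub>R e"]] show False by (rule notE)
  qed
  then obtain \<eta> where \<eta>: "\<eta> \<in> ?S" and "- (B *v d) = ?f \<eta>" by blast
  then have "B *v d = - ?f \<eta>" by (metis minus_minus)
  then show thesis using that[of "\<lambda>i. \<eta> $ i"] \<eta> by simp
qed

section \<open>Numerical inequalities behind the contraction factor\<close>

lemma ex_mult_power2_le_weighted_sums:
  fixes \<eta> v w :: "'m::finite \<Rightarrow> real"
  assumes \<eta>: "\<And>i. 0 \<le> \<eta> i" "(\<Sum>i\<in>UNIV. \<eta> i) = 1"
    and v: "\<And>i. 0 \<le> v i" and w: "\<And>i. 0 \<le> w i"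
    and V: "0 < (\<Sum>i\<in>UNIV. \<eta> i * v i)" and W: "0 < (\<Sum>i\<in>UNIV. \<eta> i * w i)"
  obtains i where "v i * (w i)\<^sup>2 \<le> (\<Sum>i\<in>UNIV. \<eta> i * v i) * (\<Sum>i\<in>UNIV. \<eta> i * w i)\<^sup>2"
proof -
  define M where "M = (\<Sum>i\<in>UNIV. \<eta> i * v i)"
  define S where "S = (\<Sum>i\<in>UNIV. \<eta> i * w i)"
  have MS: "0 < M" "0 < S" using V W by (simp_all add: M_def S_def)
  \<comment> \<open>After normalization by M and S the weighted mean of these terms is 3, so some
    index has a term of at most 3. The weight 2 on \<open>w i / S\<close> matches the square in the
    product to be bounded.\<close>
  have "(\<Sum>i\<in>UNIV. \<eta> i * (v i / M + 2 * (w i / S))) = (\<Sum>i\<in>UNIV. \<eta> i * v i) / M + 2 * ((\<Sum>i\<in>UNIV. \<eta> i * w i) / S)"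
    by (simp add: algebra_simps sum.distrib sum_divide_distrib sum_distrib_left)
  also have "\<dots> = 3" using MS by (simp flip: M_def S_def)
  finally have avg: "(\<Sum>i\<in>UNIV. \<eta> i * (v i / M + 2 * (w i / S))) = 3" .
  have "\<exists>i. v i / M + 2 * (w i / S) \<le> 3"
  proof (rule ccontr)
    assume "\<not> ?thesis"
    then have gt: "3 < v i / M + 2 * (w i / S)" for i by (auto simp: not_le)
    obtain j where "\<eta> j \<noteq> 0" using \<eta>(2) by (metis sum.neutral zero_neq_one)
    then have "0 < \<eta> j" using \<eta>(1)[of j] by simp
    have "(\<Sum>i\<in>UNIV. \<eta> i * 3) < (\<Sum>i\<in>UNIV. \<eta> i * (v i / M + 2 * (w i / S)))"
    proof (rule sum_strict_mono_ex1)
      show "\<forall>i\<in>UNIV. \<eta> i * 3 \<le> \<eta> i * (v i / M + 2 * (w i / S))"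
        using gt[THEN less_imp_le] \<eta>(1) by (auto intro!: mult_left_mono)
      show "\<exists>i\<in>UNIV. \<eta> i * 3 < \<eta> i * (v i / M + 2 * (w i / S))"
        using gt[of j] \<open>0 < \<eta> j\<close> by (intro bexI[of _ j]) (auto intro: mult_strict_left_mono)
    qed simp
    then show False using avg \<eta>(2) by (simp flip: sum_distrib_right)
  qed
  then obtain i where i: "v i / M + 2 * (w i / S) \<le> 3" ..
  \<comment> \<open>AM-GM for \<open>p\<close>, \<open>r\<close>, \<open>r\<close>, with \<open>p + 2 r \<le> 3\<close>\<close>
  define p where "p = v i / M"
  define r where "r = w i / S"
  have r: "0 \<le> r" using w MS by (simp add: r_def)
  have "p * r\<^sup>2 \<le> (3 - 2 * r) * r\<^sup>2"
    using i by (intro mult_right_mono) (simp_all add: p_def r_def)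
  also have "\<dots> = 1 - (1 - r)\<^sup>2 * (1 + 2 * r)" by (simp add: power2_eq_square algebra_simps)
  also have "\<dots> \<le> 1" using r by simp
  finally have "v i * (w i)\<^sup>2 \<le> M * S\<^sup>2"
    using MS by (simp add: p_def r_def power_divide field_simps)
  then show thesis using that by (simp add: M_def S_def)
qed

text \<open>The last two bounds on \<open>c\<close> serve the two outcomes of backtracking:
  \<open>c \<le> S * M\<close> for the full step, and the one with \<open>\<alpha> j / L j\<close>
  for a reduced step, whose index \<open>j\<close> is arbitrary here.\<close>

lemma contraction_factor_le:
  fixes \<eta> \<alpha> \<mu> L \<delta> :: "'m::finite \<Rightarrow> real"
  assumes \<eta>: "\<And>i. 0 \<le> \<eta> i" "(\<Sum>i\<in>UNIV. \<eta> i) = 1"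
    and \<delta>: "\<And>i. 0 < \<delta> i" "\<And>i. \<delta> i \<le> \<mu> i" and \<alpha>: "\<And>i. \<mu> i \<le> \<alpha> i" "\<And>i. \<alpha> i \<le> L i"
  defines "S \<equiv> \<Sum>i\<in>UNIV. \<eta> i * (\<delta> i / \<alpha> i)" and "M \<equiv> \<Sum>i\<in>UNIV. \<eta> i * (\<mu> i / \<alpha> i)"
    and "c \<equiv> MIN i. \<mu> i * (\<delta> i)\<^sup>2 / (L i) ^ 3"
  shows "0 < S" "0 < M" "0 < c" "c \<le> 1" "c \<le> S * M" "c \<le> 2 * (\<alpha> j / L j) * S * M"
proof -
  have pos: "0 < \<mu> i" "0 < \<alpha> i" "0 < L i" for i
    using \<delta>[of i] \<alpha>[of i] by linarith+
  have S0: "0 < S" and M0: "0 < M"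
  proof -
    obtain j where "\<eta> j \<noteq> 0" using \<eta>(2) by (metis sum.neutral zero_neq_one)
    then have "0 < \<eta> j" using \<eta>(1)[of j] by simp
    then show "0 < S" "0 < M" unfolding S_def M_def
      using \<eta>(1) \<delta>(1) pos by (auto intro!: sum_pos2[of _ j] simp: less_imp_le)
  qed
  have "S \<le> M" unfolding S_def M_def
    using \<eta>(1) \<delta> pos by (intro sum_mono mult_left_mono divide_right_mono) (auto intro: less_imp_le)
  have "M \<le> (\<Sum>i\<in>UNIV. \<eta> i * 1)" unfolding M_def
    using \<eta>(1) \<alpha>(1) pos by (intro sum_mono mult_left_mono) auto
  then have "M \<le> 1" using \<eta>(2) by simp
  have c_le: "c \<le> \<mu> i * (\<delta> i)\<^sup>2 / (L i) ^ 3" for i unfolding c_def by simp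
  show "0 < c" unfolding c_def using \<delta>(1) pos
    by (subst Min_gr_iff) (auto intro!: divide_pos_pos mult_pos_pos zero_less_power)
  \<comment> \<open>All ratios on the right are at most 1. Dropping the last factor leads to
    \<open>c1\<close>; dropping the first two leads to \<open>c2\<close>.\<close>
  have ratio: "\<mu> i * (\<delta> i)\<^sup>2 / (L i) ^ 3 = (\<mu> i / \<alpha> i) * (\<delta> i / \<alpha> i)\<^sup>2 * (\<alpha> i / L i) ^ 3" for i
    using pos[of i] by (simp add: field_simps power2_eq_square power3_eq_cube)
  have unit: "0 \<le> \<mu> i / \<alpha> i" "\<mu> i / \<alpha> i \<le> 1" "0 \<le> \<delta> i / \<alpha> i" "\<delta> i / \<alpha> i \<le> 1"
    "0 \<le> \<alpha> i / L i" "\<alpha> i / L i \<le> 1" for i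
    using \<delta>[of i] \<alpha>[of i] pos[of i] by auto
  obtain i where i: "\<mu> i / \<alpha> i * (\<delta> i / \<alpha> i)\<^sup>2 \<le> M * S\<^sup>2"
    using ex_mult_power2_le_weighted_sums[of \<eta> "\<lambda>i. \<mu> i / \<alpha> i" "\<lambda>i. \<delta> i / \<alpha> i"] \<eta> S0 M0 unit
    unfolding S_def M_def by blast
  have "c \<le> \<mu> i / \<alpha> i * (\<delta> i / \<alpha> i)\<^sup>2"
    using c_le[of i] unit[of i] unfolding ratio
    by (smt (verit) mult_left_le power_le_one mult_nonneg_nonneg zero_le_power)
  with i have c1: "c \<le> M * S\<^sup>2" by simp
  have "M * S\<^sup>2 = (S * M) * S" by (simp add: power2_eq_square)
  also have "\<dots> \<le> S * M" using S0 M0 \<open>S \<le> M\<close> \<open>M \<le> 1\<close> by (intro mult_left_le) auto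
  finally show "c \<le> S * M" using c1 by simp
  also have "\<dots> \<le> 1" using S0 M0 \<open>S \<le> M\<close> \<open>M \<le> 1\<close> by (intro mult_le_one) auto
  finally show "c \<le> 1" .
  define r where "r = \<alpha> j / L j"
  have r: "0 < r" using pos by (simp add: r_def)
  have "(\<mu> j / \<alpha> j) * (\<delta> j / \<alpha> j)\<^sup>2 \<le> 1"
    using unit[of j] by (intro mult_le_one power_le_one) auto
  then have "(\<mu> j / \<alpha> j) * (\<delta> j / \<alpha> j)\<^sup>2 * r ^ 3 \<le> 1 * r ^ 3"
    using r by (intro mult_right_mono) auto
  then have c2: "c \<le> r ^ 3" using c_le[of j] unfolding ratio r_def by simp
  \<comment> \<open>If \<open>S \<le> 2 * r\<close>, one factor S in \<open>c1\<close> is replaced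
    by \<open>2 * r\<close>. Otherwise r is below both S and M, and \<open>c2\<close> gives
    \<open>c \<le> r * (S * M)\<close>.\<close>
  have "c \<le> 2 * r * S * M"
  proof (cases "S \<le> 2 * r")
    case True
    have "S * (S * M) \<le> (2 * r) * (S * M)" using True S0 M0 by (intro mult_right_mono) auto
    with c1 show ?thesis by (simp add: power2_eq_square mult_ac)
  next
    case False
    have "r * r \<le> S * M" using False r \<open>S \<le> M\<close> by (intro mult_mono) auto
    then have "r * (r * r) \<le> r * (S * M)" using r by (intro mult_left_mono) auto
    moreover have "0 < r * (S * M)" using r S0 M0 by simp
    ultimately show ?thesis using c2 by (simp add: power3_eq_cube mult_ac)
  qed
  then show "c \<le> 2 * (\<alpha> j / L j) * S * M" by (simp add: r_def)
  show "0 < S" "0 < M" by (fact S0 M0)+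
qed

section \<open>Scaled gradients and bounds on the merit function\<close>

lemma direction_objective_eq:
  "direction_objective F B \<alpha> x e =
    (MAX i. ((1 / \<alpha> i) *\<^sub>R grad (\<lambda>z. F z $ i) x) \<bullet> e + 1 / 2 * (norm_wrt B e)\<^sup>2)"
  by (simp add: direction_objective_def)

lemma u0_le_iff:
  "u0 \<delta> F x \<le> ereal c \<longleftrightarrow> (\<forall>y. (MIN i. (F x $ i - F y $ i) / \<delta> i) \<le> c)"
  by (simp add: u0_def SUP_le_iff)

lemma u0_nonneg: "0 \<le> u0 \<delta> F x"
proof -
  have "(0::ereal) = ereal (MIN i. (F x $ i - F x $ i) / \<delta> i)" by simp
  also have "\<dots> \<le> u0 \<delta> F x" unfolding u0_def by (rule SUP_upper) simp
  finally show ?thesis .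
qed

text \<open>Weak duality: the inequalities of strong convexity are combined with the weights
  \<open>\<eta> i * \<delta> i / (\<alpha> i * S)\<close>, chosen so that the gradient terms add up to \<open>- (1 / S) B d\<close>.\<close>
lemma u0_le_dual:
  assumes B: "pos_definite B"
    and sc: "\<And>i. strongly_convex_relative (\<mu> i) B (\<lambda>z. F z $ i)"
    and \<eta>: "\<And>i. 0 \<le> \<eta> i"
    and \<delta>: "\<And>i. 0 < \<delta> i" and \<alpha>: "\<And>i. 0 < \<alpha> i"
    and d: "B *v d = - (\<Sum>i\<in>UNIV. \<eta> i *\<^sub>R ((1 / \<alpha> i) *\<^sub>R grad (\<lambda>z. F z $ i) x))"
  defines "S \<equiv> \<Sum>i\<in>UNIV. \<eta> i * (\<delta> i / \<alpha> i)" and "M \<equiv> \<Sum>i\<in>UNIV. \<eta> i * (\<mu> i / \<alpha> i)"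
  assumes SM: "0 < S" "0 < M"
  shows "u0 \<delta> F x \<le> ereal ((norm_wrt B d)\<^sup>2 / (2 * S * M))"
  unfolding u0_le_iff
proof
  fix y
  let ?g = "\<lambda>i. grad (\<lambda>z. F z $ i) x" and ?m = "MIN i. (F x $ i - F y $ i) / \<delta> i"
  define e where "e = y - x"
  let ?Q = "(norm_wrt B e)\<^sup>2"
  have "?m * (\<eta> i * (\<delta> i / \<alpha> i)) \<le> - (\<eta> i * ((1 / \<alpha> i) * (?g i \<bullet> e))) - \<eta> i * (\<mu> i / \<alpha> i) * (?Q / 2)" for i
  proof -
    have "?m \<le> (F x $ i - F y $ i) / \<delta> i" by simp
    then have "?m * \<delta> i \<le> F x $ i - F y $ i" using \<delta>[of i] by (simp add: field_simps)
    also have "\<dots> \<le> - (?g i \<bullet> e) - \<mu> i / 2 * ?Q"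
      using sc[of i] unfolding strongly_convex_relative_def e_def by (smt (verit))
    finally have "?m * \<delta> i * (\<eta> i / \<alpha> i) \<le> (- (?g i \<bullet> e) - \<mu> i / 2 * ?Q) * (\<eta> i / \<alpha> i)"
      using \<eta>[of i] \<alpha>[of i] by (intro mult_right_mono) auto
    then show ?thesis by (simp add: algebra_simps)
  qed
  then have "(\<Sum>i\<in>UNIV. ?m * (\<eta> i * (\<delta> i / \<alpha> i)))
      \<le> (\<Sum>i\<in>UNIV. - (\<eta> i * ((1 / \<alpha> i) * (?g i \<bullet> e))) - \<eta> i * (\<mu> i / \<alpha> i) * (?Q / 2))"
    by (rule sum_mono)
  then have "?m * S \<le> (B *v d) \<bullet> e - M * (?Q / 2)"
    by (simp only: d S_def M_def sum_subtractf sum_distrib_left sum_distrib_right sum_negf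
        inner_minus_left inner_sum_left inner_scaleR_left)
  \<comment> \<open>This expands the nonnegative square of
    \<open>norm_wrt B (d + (- M) *\<^sub>R e)\<close>. The scale M makes the \<open>?Q\<close> terms
    cancel once the previous inequality is multiplied by \<open>2 * M\<close>.\<close>
  moreover have "2 * M * ((B *v d) \<bullet> e) \<le> (norm_wrt B d)\<^sup>2 + M\<^sup>2 * ?Q"
    using norm_wrt_add_power2[OF B, of d "(- M) *\<^sub>R e"] norm_wrt_scaleR_power2[OF B, of "- M" e]
      zero_le_power2[of "norm_wrt B (d + (- M) *\<^sub>R e)"] by simp
  ultimately have "2 * M * (?m * S) \<le> (norm_wrt B d)\<^sup>2"
    using mult_left_mono[of "?m * S" "(B *v d) \<bullet> e - M * (?Q / 2)" "2 * M"] SM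
    by (simp add: power2_eq_square algebra_simps)
  then show "?m \<le> (norm_wrt B d)\<^sup>2 / (2 * S * M)"
    using SM by (simp add: field_simps)
qed

text \<open>For each fixed \<open>y\<close>, the index attaining the minimum at \<open>x\<close>
  already witnesses the decrease of the minimum at \<open>x'\<close>.\<close>

lemma u0_le_minus:
  assumes "u0 \<delta> F x \<le> ereal u" and "\<And>i. c \<le> (F x $ i - F x' $ i) / \<delta> i"
  shows "u0 \<delta> F x' \<le> ereal (u - c)"
  unfolding u0_le_iff
proof
  fix y
  have "(MIN i. (F x $ i - F y $ i) / \<delta> i) \<in> range (\<lambda>i. (F x $ i - F y $ i) / \<delta> i)"
    by (rule Min_in) auto
  then obtain i where i: "(MIN i. (F x $ i - F y $ i) / \<delta> i) = (F x $ i - F y $ i) / \<delta> i" by blast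
  have "(MIN i. (F x' $ i - F y $ i) / \<delta> i) \<le> (F x' $ i - F y $ i) / \<delta> i" by simp
  also have "\<dots> \<le> (F x $ i - F y $ i) / \<delta> i - c"
    using assms(2)[of i] by (simp add: diff_divide_distrib)
  also have "\<dots> \<le> u - c" using assms(1) i unfolding u0_le_iff by (metis diff_right_mono)
  finally show "(MIN i. (F x' $ i - F y $ i) / \<delta> i) \<le> u - c" .
qed

section \<open>One iteration: step size and decrease of the merit function\<close>

lemma backtracking_step_lower_bound:
  assumes B: "pos_definite B"
    and sm: "\<And>i. smooth_relative (L i) B (\<lambda>z. F z $ i)"
    and \<alpha>: "\<And>i. 0 < \<alpha> i" and L: "\<And>i. 0 < L i"
    and d: "\<And>i. ((1 / \<alpha> i) *\<^sub>R grad (\<lambda>z. F z $ i) x) \<bullet> d \<le> - (norm_wrt B d)\<^sup>2" "d \<noteq> 0"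
    and t: "backtracking_step F \<sigma> \<gamma> x d t" and \<sigma>: "\<sigma> < 1" and \<gamma>: "0 < \<gamma>" "\<gamma> < 1"
  shows "t = 1 \<or> (\<exists>j. 2 * \<gamma> * (1 - \<sigma>) * (\<alpha> j / L j) \<le> t)"
proof -
  let ?g = "\<lambda>i. grad (\<lambda>z. F z $ i) x" and ?Q = "(norm_wrt B d)\<^sup>2"
  from t obtain n where n: "t = \<gamma> ^ n"
    and max: "\<And>m. armijo F \<sigma> x d (\<gamma> ^ m) \<Longrightarrow> \<gamma> ^ m \<le> t"
    unfolding backtracking_step_def by blast
  show ?thesis
  proof (cases n)
    case 0
    with n show ?thesis by simp
  next
    case (Suc m)
    \<comment> \<open>\<open>s\<close> is the trial step just before \<open>t\<close>. Maximality of
      \<open>t\<close> means that \<open>s\<close> was rejected, so some objective \<open>j\<close>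
      violates the Armijo test at \<open>s\<close>; relative smoothness of that objective then
      bounds \<open>s\<close> from below.\<close>
    define s where "s = \<gamma> ^ m"
    have s: "0 < s" "t = \<gamma> * s" using \<gamma> n Suc by (simp_all add: s_def)
    then have "t < s" using \<gamma> by simp
    then have "\<not> armijo F \<sigma> x d s" using max[of m] by (auto simp: s_def)
    then obtain j where j: "s * \<sigma> * (?g j \<bullet> d) < F (x + s *\<^sub>R d) $ j - F x $ j"
      unfolding armijo_def by (auto simp: not_le)
    have "F (x + s *\<^sub>R d) $ j \<le> F x $ j + ?g j \<bullet> (s *\<^sub>R d) + L j / 2 * (norm_wrt B (s *\<^sub>R d))\<^sup>2"
      using sm[of j] unfolding smooth_relative_def by (metis add_diff_cancel_left')
    then have "s * (\<sigma> * (?g j \<bullet> d)) < s * (?g j \<bullet> d + s * (L j / 2 * ?Q))"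
      using j unfolding norm_wrt_scaleR_power2[OF B] by (simp add: power2_eq_square algebra_simps)
    then have "\<sigma> * (?g j \<bullet> d) < ?g j \<bullet> d + s * (L j / 2 * ?Q)"
      using s(1) by (simp only: mult_less_cancel_left_pos)
    then have "(1 - \<sigma>) * - (?g j \<bullet> d) < s * (L j / 2) * ?Q" by (simp add: algebra_simps)
    moreover have "\<alpha> j * ?Q \<le> - (?g j \<bullet> d)"
      using d(1)[of j] \<alpha>[of j] by (simp add: field_simps)
    then have "(1 - \<sigma>) * (\<alpha> j * ?Q) \<le> (1 - \<sigma>) * - (?g j \<bullet> d)"
      using \<sigma> by (intro mult_left_mono) auto
    ultimately have "((1 - \<sigma>) * \<alpha> j) * ?Q < (s * (L j / 2)) * ?Q" by simp
    moreover have "0 < ?Q"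
      using B d(2) unfolding norm_wrt_power2[OF B] pos_definite_def by simp
    ultimately have "(1 - \<sigma>) * \<alpha> j < s * (L j / 2)" by (simp only: mult_less_cancel_right_pos)
    then have "2 * (1 - \<sigma>) * (\<alpha> j / L j) < s" using L[of j] by (simp add: field_simps)
    then have "\<gamma> * (2 * (1 - \<sigma>) * (\<alpha> j / L j)) \<le> t"
      unfolding s(2) using \<gamma> by (intro mult_left_mono) auto
    then show ?thesis by (auto simp: mult_ac)
  qed
qed

text \<open>The constants are tied to a single matrix \<open>B\<close>, so the lemma serves both for
  the given constants of an iteration and for uniform ones. The conclusion
  \<open>x' \<noteq> x\<close> provides the hypothesis \<open>xp \<noteq> x\<close> for the next
  iteration.\<close>

lemma bbdmo_vm_step_decrease:
  fixes L \<mu> \<delta> :: "'m::finite \<Rightarrow> real"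
  assumes step: "bbdmo_vm_step F \<alpha>min \<alpha>max \<sigma> \<gamma> B xp x x'" and "xp \<noteq> x" and B: "pos_definite B"
    and \<sigma>: "0 < \<sigma>" "\<sigma> < 1" and \<gamma>: "0 < \<gamma>" "\<gamma> < 1"
    and sm: "\<And>i. smooth_relative (L i) B (\<lambda>z. F z $ i)"
    and sc: "\<And>i. strongly_convex_relative (\<mu> i) B (\<lambda>z. F z $ i)"
    and \<delta>: "\<And>i. 0 < \<delta> i" "\<And>i. \<delta> i \<le> \<mu> i"
    and \<alpha>min: "\<And>i. \<alpha>min \<le> L i" and \<alpha>max: "\<And>i. \<mu> i \<le> \<alpha>max"
  defines "c \<equiv> MIN i. \<mu> i * (\<delta> i)\<^sup>2 / (L i) ^ 3"
  obtains u u' where "u0 \<delta> F x = ereal u" "u0 \<delta> F x' = ereal u'"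
    "u' \<le> (1 - 2 * \<gamma> * \<sigma> * (1 - \<sigma>) * c) * u"
    "\<sigma> * (norm_wrt B (x' - x))\<^sup>2 \<le> u - u'" "0 < c" "c \<le> 1" "x' \<noteq> x"
proof -
  let ?g = "\<lambda>i. grad (\<lambda>z. F z $ i) x"
  from step obtain \<alpha> d t where
    \<alpha>_eq: "\<And>i. \<alpha> i = bb_coeff \<alpha>min \<alpha>max B (x - xp) (?g i - grad (\<lambda>z. F z $ i) xp)"
    and am: "is_arg_min (direction_objective F B \<alpha> x) (\<lambda>_. True) d" and "d \<noteq> 0"
    and bt: "backtracking_step F \<sigma> \<gamma> x d t" and x': "x' = x + t *\<^sub>R d"
    unfolding bbdmo_vm_step_def by blast
  have \<alpha>: "\<mu> i \<le> \<alpha> i" "\<alpha> i \<le> L i" for i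
    unfolding \<alpha>_eq
    using bb_coeff_bounds[OF B \<open>xp \<noteq> x\<close>[symmetric] sc[of i] sm[of i] _ \<alpha>min \<alpha>max] \<delta>[of i]
    by simp_all
  have pos: "0 < \<mu> i" "0 < \<alpha> i" "0 < L i" for i
    using \<delta>[of i] \<alpha>[of i] by linarith+
  let ?h = "\<lambda>i. (1 / \<alpha> i) *\<^sub>R ?g i" and ?Q = "(norm_wrt B d)\<^sup>2"
  have min: "(MAX i. ?h i \<bullet> d + 1 / 2 * (norm_wrt B d)\<^sup>2) \<le> (MAX i. ?h i \<bullet> e + 1 / 2 * (norm_wrt B e)\<^sup>2)" for e
    using am unfolding is_arg_min_linorder direction_objective_eq by blast
  have hd: "?h i \<bullet> d \<le> - ?Q" for i
    by (rule argmin_max_inner_le[OF B]) (rule min)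
  obtain \<eta> where \<eta>: "\<And>i. 0 \<le> \<eta> i" "(\<Sum>i\<in>UNIV. \<eta> i) = 1"
    and Bd: "B *v d = - (\<Sum>i\<in>UNIV. \<eta> i *\<^sub>R ?h i)"
    by (rule argmin_max_multipliers[OF B min]) blast
  define S where "S = (\<Sum>i\<in>UNIV. \<eta> i * (\<delta> i / \<alpha> i))"
  define M where "M = (\<Sum>i\<in>UNIV. \<eta> i * (\<mu> i / \<alpha> i))"
  note factor = contraction_factor_le[where \<eta> = \<eta> and \<delta> = \<delta> and \<mu> = \<mu> and \<alpha> = \<alpha> and L = L,
      OF \<eta> \<delta> \<alpha>, folded S_def M_def c_def]
  have u_le: "u0 \<delta> F x \<le> ereal (?Q / (2 * S * M))"
    unfolding S_def M_def
    by (rule u0_le_dual[OF B sc \<eta>(1) \<delta>(1) pos(2) Bd]) (use factor(1,2) in \<open>simp_all only: S_def M_def\<close>)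
  \<comment> \<open>Weak duality bounds the supremum by a real number and the choice
    \<open>y = x\<close> bounds it below by 0, so it is finite.\<close>
  obtain u where u: "u0 \<delta> F x = ereal u"
    using u_le u0_nonneg[of \<delta> F x] by (cases "u0 \<delta> F x") auto
  have t: "0 < t" "t \<le> 1"
    using bt \<gamma> unfolding backtracking_step_def by (auto simp: power_le_one)
  have Q0: "0 < ?Q"
    using B \<open>d \<noteq> 0\<close> unfolding norm_wrt_power2[OF B] pos_definite_def by simp
  have dec: "\<sigma> * t * ?Q \<le> (F x $ i - F x' $ i) / \<delta> i" for i
  proof -
    have "F x' $ i - F x $ i \<le> t * \<sigma> * (?g i \<bullet> d)"
      using bt unfolding backtracking_step_def armijo_def x' by blast
    moreover have "\<alpha> i * ?Q \<le> - (?g i \<bullet> d)"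
      using hd[of i] pos(2)[of i] by (simp add: field_simps)
    moreover have "\<delta> i * ?Q \<le> \<alpha> i * ?Q"
      using \<delta>(2)[of i] \<alpha>(1)[of i] by (intro mult_right_mono) auto
    ultimately have "(t * \<sigma>) * (\<delta> i * ?Q) \<le> F x $ i - F x' $ i"
      using mult_left_mono[of "\<delta> i * ?Q" "- (?g i \<bullet> d)" "t * \<sigma>"] t \<sigma> by simp
    then show ?thesis using \<delta>(1)[of i] by (simp add: field_simps)
  qed
  have u'_le: "u0 \<delta> F x' \<le> ereal (u - \<sigma> * t * ?Q)"
    by (rule u0_le_minus[where x = x]) (use u dec in simp_all)
  then obtain u' where u': "u0 \<delta> F x' = ereal u'"
    using u0_nonneg[of \<delta> F x'] by (cases "u0 \<delta> F x'") auto
  have ud: "u' \<le> u - \<sigma> * t * ?Q" using u'_le u' by simp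
  have u0: "0 \<le> u" using u0_nonneg[of \<delta> F x] u by simp
  have "\<gamma> * (1 - \<sigma>) * c \<le> t * (S * M)"
    using backtracking_step_lower_bound[OF B sm pos(2,3) hd \<open>d \<noteq> 0\<close> bt \<sigma>(2) \<gamma>]
  proof (elim disjE exE)
    assume "t = 1"
    have "\<gamma> * (1 - \<sigma>) \<le> 1" using \<gamma> \<sigma> by (intro mult_le_one) auto
    then have "\<gamma> * (1 - \<sigma>) * c \<le> 1 * c" using factor(3) by (intro mult_right_mono) auto
    with \<open>t = 1\<close> factor(5) show ?thesis by simp
  next
    fix j assume j: "2 * \<gamma> * (1 - \<sigma>) * (\<alpha> j / L j) \<le> t"
    have "(\<gamma> * (1 - \<sigma>)) * c \<le> (\<gamma> * (1 - \<sigma>)) * (2 * (\<alpha> j / L j) * S * M)"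
      using factor(6)[of j] \<gamma> \<sigma> by (intro mult_left_mono) auto
    also have "\<dots> = (2 * \<gamma> * (1 - \<sigma>) * (\<alpha> j / L j)) * (S * M)" by (simp add: mult_ac)
    also have "\<dots> \<le> t * (S * M)" using j factor(1,2) by (intro mult_right_mono) auto
    finally show ?thesis .
  qed
  \<comment> \<open>Weak duality in the form \<open>u * (2 * S * M) \<le> ?Q\<close> turns the
    guaranteed decrease \<open>\<sigma> * t * ?Q\<close> into a fraction of
    \<open>u\<close>.\<close>
  then have "2 * \<sigma> * u * (\<gamma> * (1 - \<sigma>) * c) \<le> 2 * \<sigma> * u * (t * (S * M))"
    using \<sigma> u0 by (intro mult_left_mono) auto
  also have "\<dots> = \<sigma> * t * (u * (2 * S * M))" by (simp add: mult_ac)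
  also have "\<dots> \<le> \<sigma> * t * ?Q"
    using u_le u factor(1,2) \<sigma> t by (intro mult_left_mono) (auto simp: field_simps)
  finally have "u' \<le> (1 - 2 * \<gamma> * \<sigma> * (1 - \<sigma>) * c) * u"
    using ud by (simp add: algebra_simps)
  moreover have "\<sigma> * (norm_wrt B (x' - x))\<^sup>2 \<le> u - u'"
  proof -
    have "t\<^sup>2 * ?Q \<le> t * ?Q" using t
      by (intro mult_right_mono) (auto simp: power2_eq_square intro: mult_left_le)
    then have "\<sigma> * (t\<^sup>2 * ?Q) \<le> \<sigma> * (t * ?Q)" using \<sigma> by (intro mult_left_mono) auto
    then show ?thesis using ud by (simp add: x' norm_wrt_scaleR_power2[OF B] mult.assoc)
  qed
  moreover have "x' \<noteq> x" using t \<open>d \<noteq> 0\<close> by (simp add: x')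
  ultimately show thesis using that u u' factor(3,4) by blast
qed

section \<open>From decay of the merit function to a Pareto limit\<close>

lemma geometric_steps_convergent:
  fixes x :: "nat \<Rightarrow> 'a::banach"
  assumes "\<And>k. norm (x (Suc k) - x k) \<le> C * q ^ k" and "0 \<le> q" "q < 1"
  shows "convergent x"
proof -
  have "summable (\<lambda>k. x (Suc k) - x k)"
  proof (rule summable_comparison_test'[where N = 0])
    show "summable (\<lambda>k. C * q ^ k)" using assms(2,3) by (intro summable_mult summable_geometric) simp
  qed (rule assms(1))
  from summable_LIMSEQ[OF this] have "(\<lambda>n. x n - x 0) \<longlonglongrightarrow> (\<Sum>k. x (Suc k) - x k)"
    by (simp only: sum_lessThan_telescope)
  from tendsto_add[OF this tendsto_const[of "x 0"]] show ?thesis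
    unfolding diff_add_cancel by (rule convergentI)
qed

text \<open>If \<open>y\<close> dominated \<open>x\<close>, strong convexity would make their
  midpoint strictly better than \<open>x\<close> in every objective, and that midpoint would force
  \<open>u0\<close> to be positive at \<open>x\<close>.\<close>

lemma pareto_solution_if_u0_le_0:
  assumes B: "pos_definite B" and sc: "\<And>i. strongly_convex_relative (\<mu> i) B (\<lambda>z. F z $ i)"
    and "\<And>i. 0 < \<mu> i" and \<delta>: "\<And>i. 0 < \<delta> i" and u: "u0 \<delta> F x \<le> 0"
  shows "pareto_solution F x"
  unfolding pareto_solution_def
proof (intro notI, elim exE conjE)
  fix y assume le: "\<forall>i. F y $ i \<le> F x $ i" and "F y \<noteq> F x"
  then have "y \<noteq> x" by auto
  define z where "z = (1 / 2) *\<^sub>R (x + y)"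
  have yx: "y - z = (1 / 2) *\<^sub>R (y - x)" "x - z = - ((1 / 2) *\<^sub>R (y - x))"
    by (simp_all add: z_def vec_eq_iff field_simps)
  have pos: "0 < (norm_wrt B (y - z))\<^sup>2"
    using B \<open>y \<noteq> x\<close> unfolding norm_wrt_scaleR_power2[OF B] norm_wrt_power2[OF B] pos_definite_def yx
    by (simp add: matrix_vector_mult_scaleR)
  have lt: "F z $ i < F x $ i" for i
  proof -
    have "F z $ i + grad (\<lambda>z. F z $ i) z \<bullet> (y - z) + \<mu> i / 2 * (norm_wrt B (y - z))\<^sup>2 \<le> F y $ i"
      "F z $ i + grad (\<lambda>z. F z $ i) z \<bullet> (x - z) + \<mu> i / 2 * (norm_wrt B (x - z))\<^sup>2 \<le> F x $ i"
      using sc[of i] unfolding strongly_convex_relative_def by blast+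
    moreover have "0 < \<mu> i / 2 * (norm_wrt B (y - z))\<^sup>2" "0 \<le> \<mu> i / 2 * (norm_wrt B (x - z))\<^sup>2"
      using pos assms(3)[of i] by simp_all
    moreover have "grad (\<lambda>z. F z $ i) z \<bullet> (x - z) = - (grad (\<lambda>z. F z $ i) z \<bullet> (y - z))"
      by (simp add: yx)
    ultimately show ?thesis using le[rule_format, of i] by linarith
  qed
  have "0 < (MIN i. (F x $ i - F z $ i) / \<delta> i)"
    using lt \<delta> by (subst Min_gr_iff) auto
  moreover have "(MIN i. (F x $ i - F z $ i) / \<delta> i) \<le> 0"
    using u u0_le_iff[of \<delta> F x 0] by (simp add: zero_ereal_def)
  ultimately show False by linarith
qed

lemma tendsto_Min_image:
  fixes f :: "'a \<Rightarrow> 'i \<Rightarrow> real"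
  assumes "finite I" "I \<noteq> {}" and "\<And>i. i \<in> I \<Longrightarrow> ((\<lambda>k. f k i) \<longlongrightarrow> l i) A"
  shows "((\<lambda>k. MIN i\<in>I. f k i) \<longlongrightarrow> (MIN i\<in>I. l i)) A"
  using assms
proof (induction I rule: finite_ne_induct)
  case (insert j I)
  then show ?case by (simp add: tendsto_min)
qed simp

text \<open>Lower semicontinuity of \<open>u0\<close> along the sequence: for each fixed
  \<open>y\<close> the finite minimum is continuous, so the limit is taken before the supremum over
  \<open>y\<close>.\<close>

lemma u0_limit_le:
  assumes x: "x \<longlonglongrightarrow> xs" and F: "isCont F xs"
    and u: "\<And>k. u0 \<delta> F (x k) \<le> ereal (u k)" and "u \<longlonglongrightarrow> c"
  shows "u0 \<delta> F xs \<le> ereal c"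
  unfolding u0_le_iff
proof
  fix y
  have "(\<lambda>k. F (x k) $ i) \<longlonglongrightarrow> F xs $ i" for i
    by (intro tendsto_vec_nth isCont_tendsto_compose[OF F x])
  then have "(\<lambda>k. MIN i. (F (x k) $ i - F y $ i) / \<delta> i) \<longlonglongrightarrow> (MIN i. (F xs $ i - F y $ i) / \<delta> i)"
    unfolding divide_inverse by (intro tendsto_Min_image tendsto_mult tendsto_diff tendsto_const) auto
  then show "(MIN i. (F xs $ i - F y $ i) / \<delta> i) \<le> c"
    by (rule LIMSEQ_le[OF _ \<open>u \<longlonglongrightarrow> c\<close>]) (use u u0_le_iff in blast)
qed

lemma smooth_relative_transfer:
  assumes "smooth_relative L B h" and "\<And>v. L * (norm_wrt B v)\<^sup>2 \<le> L' * (norm_wrt B' v)\<^sup>2"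
  shows "smooth_relative L' B' h"
  unfolding smooth_relative_def
proof (intro conjI allI)
  show "h differentiable at x" for x using assms(1) unfolding smooth_relative_def by blast
  show "h y \<le> h x + grad h x \<bullet> (y - x) + L' / 2 * (norm_wrt B' (y - x))\<^sup>2" for x y
    using assms(1)[unfolded smooth_relative_def, THEN conjunct2, rule_format, of y x]
      assms(2)[of "y - x"] by linarith
qed

lemma strongly_convex_relative_mono:
  assumes "strongly_convex_relative \<mu> B h" and "\<mu>' \<le> \<mu>"
  shows "strongly_convex_relative \<mu>' B h"
  unfolding strongly_convex_relative_def
proof (intro conjI allI)
  show "h differentiable at x" for x using assms(1) unfolding strongly_convex_relative_def by blast
  show "h y \<ge> h x + grad h x \<bullet> (y - x) + \<mu>' / 2 * (norm_wrt B (y - x))\<^sup>2" for x y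
    using assms(1)[unfolded strongly_convex_relative_def, THEN conjunct2, rule_format, of x y]
      mult_right_mono[OF assms(2), of "(norm_wrt B (y - x))\<^sup>2"] by simp
qed

section \<open>Contraction with the given constants, convergence with uniform ones\<close>

theorem theorem5p3:
  fixes F :: "real^'n \<Rightarrow> real^'m"
    and \<alpha>min \<alpha>max \<sigma> \<gamma> a b :: real
    and B :: "nat \<Rightarrow> real^'n^'n"
    and xm :: "real^'n" and x :: "nat \<Rightarrow> real^'n"
    and L \<mu> :: "nat \<Rightarrow> 'm \<Rightarrow> real" and \<delta> :: "'m \<Rightarrow> real"
  assumes "continuously_differentiable F"
    and "0 < \<alpha>min" and "\<alpha>min \<le> \<alpha>max"
    and "0 < \<sigma>" and "\<sigma> < 1" and "0 < \<gamma>" and "\<gamma> < 1"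
    and "bbdmo_vm_sequence F \<alpha>min \<alpha>max \<sigma> \<gamma> B xm x"
    and "\<And>k. \<not> pareto_critical F (x k)"
    and "a > 0" and "b > 0"
    and "\<And>k. (a *\<^sub>R mat 1) \<preceq>\<^sub>L B k" and "\<And>k. B k \<preceq>\<^sub>L (b *\<^sub>R mat 1)"
    and "\<And>k i. smooth_relative (L k i) (B k) (\<lambda>z. F z $ i)"
    and "\<And>k i. strongly_convex_relative (\<mu> k i) (B k) (\<lambda>z. F z $ i)"
    and "\<And>i. \<delta> i > 0" and "\<And>k i. \<mu> k i \<ge> \<delta> i"
    and "\<And>k i. \<alpha>min \<le> L k i" and "\<And>k i. \<alpha>max \<ge> \<mu> k i"
  shows "(\<exists>xs. pareto_solution F xs \<and> x \<longlonglongrightarrow> xs) \<and>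
    (\<forall>k. u0 \<delta> F (x (Suc k)) \<le>
       ereal (1 - 2 * \<gamma> * \<sigma> * (1 - \<sigma>) * (MIN i. \<mu> k i * (\<delta> i)\<^sup>2 / (L k i) ^ 3)) * u0 \<delta> F (x k))"
proof (rule conjI)
  define xp where "xp k = (case k of 0 \<Rightarrow> xm | Suc j \<Rightarrow> x j)" for k
  have B: "pos_definite (B k)" and x0: "xm \<noteq> x 0"
    and step: "bbdmo_vm_step F \<alpha>min \<alpha>max \<sigma> \<gamma> (B k) (xp k) (x k) (x (Suc k))" for k
    using assms(8) unfolding bbdmo_vm_sequence_def xp_def by blast+
  note sm = assms(14) and sc = assms(15) and \<delta> = assms(16) and \<mu> = assms(17)
  have nb: "a * (norm v)\<^sup>2 \<le> (norm_wrt (B k) v)\<^sup>2" "(norm_wrt (B k) v)\<^sup>2 \<le> b * (norm v)\<^sup>2" for k v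
    using norm_wrt_bounds[OF B assms(12,13)] by auto
  \<comment> \<open>The bounds on \<open>bb_coeff\<close> require distinct consecutive iterates;
    each application of the step lemma hands this on to the next index.\<close>
  have "xp k \<noteq> x k" for k
  proof (induction k)
    case 0
    then show ?case using x0 by (simp add: xp_def)
  next
    case (Suc k)
    have "x (Suc k) \<noteq> x k"
      by (rule bbdmo_vm_step_decrease[OF step Suc B assms(4-7) sm sc \<delta> \<mu> assms(18,19)])
    then show ?case by (simp add: xp_def)
  qed
  note decrease = bbdmo_vm_step_decrease[OF step this B assms(4-7)]

  show "\<forall>k. u0 \<delta> F (x (Suc k)) \<le>
      ereal (1 - 2 * \<gamma> * \<sigma> * (1 - \<sigma>) * (MIN i. \<mu> k i * (\<delta> i)\<^sup>2 / (L k i) ^ 3)) * u0 \<delta> F (x k)"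
  proof
    fix k
    obtain u u' where "u0 \<delta> F (x k) = ereal u" "u0 \<delta> F (x (Suc k)) = ereal u'"
      "u' \<le> (1 - 2 * \<gamma> * \<sigma> * (1 - \<sigma>) * (MIN i. \<mu> k i * (\<delta> i)\<^sup>2 / (L k i) ^ 3)) * u"
      by (rule decrease[OF sm sc \<delta> \<mu> assms(18,19)])
    then show "u0 \<delta> F (x (Suc k)) \<le>
        ereal (1 - 2 * \<gamma> * \<sigma> * (1 - \<sigma>) * (MIN i. \<mu> k i * (\<delta> i)\<^sup>2 / (L k i) ^ 3)) * u0 \<delta> F (x k)"
      by simp
  qed

  \<comment> \<open>The constants \<open>L k i\<close> may be unbounded in \<open>k\<close>; transferring \<open>L 0 i\<close> to every
    \<open>B k\<close> gives a contraction factor that does not depend on \<open>k\<close>.\<close>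
  define \<Lambda> where "\<Lambda> i = max \<alpha>min (L 0 i * b / a)" for i
  have L0: "0 < L 0 i" for i using assms(2) assms(18)[of 0 i] by linarith
  have sm': "smooth_relative (\<Lambda> i) (B k) (\<lambda>z. F z $ i)" for i k
  proof (rule smooth_relative_transfer[OF sm[of 0 i]])
    fix v
    have "L 0 i * (norm_wrt (B 0) v)\<^sup>2 \<le> L 0 i * (b * (norm v)\<^sup>2)"
      using nb(2)[of 0 v] L0[of i] by (intro mult_left_mono) auto
    also have "\<dots> = L 0 i * b / a * (a * (norm v)\<^sup>2)" using \<open>a > 0\<close> by simp
    also have "\<dots> \<le> L 0 i * b / a * (norm_wrt (B k) v)\<^sup>2"
      using nb(1)[of v k] L0[of i] \<open>a > 0\<close> \<open>b > 0\<close> by (intro mult_left_mono) auto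
    also have "\<dots> \<le> \<Lambda> i * (norm_wrt (B k) v)\<^sup>2"
      unfolding \<Lambda>_def by (intro mult_right_mono) auto
    finally show "L 0 i * (norm_wrt (B 0) v)\<^sup>2 \<le> \<Lambda> i * (norm_wrt (B k) v)\<^sup>2" .
  qed
  have sc': "strongly_convex_relative (\<delta> i) (B k) (\<lambda>z. F z $ i)" for i k
    using sc \<mu> by (rule strongly_convex_relative_mono)
  \<comment> \<open>The maximum in the definition of \<Lambda> secures the first inequality, so
    \<Lambda> and \<delta> satisfy the same standing conventions as \<open>L k\<close> and
    \<open>\<mu> k\<close>.\<close>
  have \<Lambda>: "\<alpha>min \<le> \<Lambda> i" and \<delta>max: "\<delta> i \<le> \<alpha>max" for i
    using \<mu>[of i 0] assms(19)[of 0 i] by (auto simp: \<Lambda>_def)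
  define c where "c = (MIN i. \<delta> i * (\<delta> i)\<^sup>2 / (\<Lambda> i) ^ 3)"
  define q where "q = 1 - 2 * \<gamma> * \<sigma> * (1 - \<sigma>) * c"
  define u where "u k = real_of_ereal (u0 \<delta> F (x k))" for k
  \<comment> \<open>The step lemma is applied again, now with \<Lambda> and \<delta> as smoothness
    and convexity constants, so that \<open>q\<close> is the same for all iterations.\<close>
  have dec: "u0 \<delta> F (x k) = ereal (u k) \<and> u (Suc k) \<le> q * u k \<and>
      \<sigma> * (norm_wrt (B k) (x (Suc k) - x k))\<^sup>2 \<le> u k - u (Suc k) \<and> 0 < c \<and> c \<le> 1" for k
  proof -
    obtain v v' where "u0 \<delta> F (x k) = ereal v" "u0 \<delta> F (x (Suc k)) = ereal v'"
      "v' \<le> q * v" "\<sigma> * (norm_wrt (B k) (x (Suc k) - x k))\<^sup>2 \<le> v - v'" "0 < c" "c \<le> 1"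
      unfolding q_def c_def by (rule decrease[OF sm' sc' \<delta> order_refl \<Lambda> \<delta>max])
    then show ?thesis by (simp add: u_def)
  qed
  have u_nonneg: "0 \<le> u k" for k
    using u0_nonneg[of \<delta> F "x k"] by (simp add: u_def real_of_ereal_pos)
  \<comment> \<open>Nonnegativity rests on \<open>c \<le> 1\<close> and on
    \<open>2 * (\<sigma> * (1 - \<sigma>)) \<le> 1\<close>; it is what permits iterating the
    contraction and taking \<open>sqrt q\<close>.\<close>
  have q: "0 \<le> q" "q < 1"
  proof -
    have "\<gamma> * c \<le> 1" using dec assms(6,7) by (intro mult_le_one) (auto intro: less_imp_le)
    moreover have "2 * (\<sigma> * (1 - \<sigma>)) \<le> 1"
      using zero_le_power2[of "1 - 2 * \<sigma>"] by (simp add: power2_eq_square algebra_simps)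
    moreover have "0 \<le> 2 * (\<sigma> * (1 - \<sigma>))" using assms(4,5) by simp
    ultimately have "(\<gamma> * c) * (2 * (\<sigma> * (1 - \<sigma>))) \<le> 1"
      using mult_right_mono[of "\<gamma> * c" 1 "2 * (\<sigma> * (1 - \<sigma>))"] by linarith
    then show "0 \<le> q" by (simp add: q_def mult_ac)
    have "0 < 2 * \<gamma> * \<sigma> * (1 - \<sigma>) * c"
      using assms(4-7) dec by (intro mult_pos_pos) auto
    then show "q < 1" by (simp add: q_def)
  qed
  have u_le: "u k \<le> u 0 * q ^ k" for k
  proof (induction k)
    case (Suc k)
    have "u (Suc k) \<le> q * u k" using dec by blast
    also have "\<dots> \<le> q * (u 0 * q ^ k)" using Suc q by (intro mult_left_mono) auto
    finally show ?case by (simp add: mult_ac)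
  qed simp
  \<comment> \<open>The squared step is at most \<open>u k / (a * \<sigma>)\<close>, because
    \<open>u\<close> is nonnegative at the next iterate; hence step lengths decay with ratio
    \<open>sqrt q\<close>.\<close>
  have "norm (x (Suc k) - x k) \<le> sqrt (u 0 / (a * \<sigma>)) * sqrt q ^ k" for k
  proof -
    have "\<sigma> * (a * (norm (x (Suc k) - x k))\<^sup>2) \<le> \<sigma> * (norm_wrt (B k) (x (Suc k) - x k))\<^sup>2"
      using nb(1) assms(4) by (intro mult_left_mono) auto
    also have "\<dots> \<le> u 0 * q ^ k"
      using dec[of k] u_nonneg[of "Suc k"] u_le[of k] by linarith
    finally have "(norm (x (Suc k) - x k))\<^sup>2 \<le> u 0 / (a * \<sigma>) * q ^ k"
      using \<open>a > 0\<close> assms(4) by (simp add: field_simps)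
    then have "norm (x (Suc k) - x k) \<le> sqrt (u 0 / (a * \<sigma>) * q ^ k)" by (rule real_le_rsqrt)
    then show ?thesis by (simp only: real_sqrt_mult real_sqrt_power)
  qed
  moreover have "0 \<le> sqrt q" "sqrt q < 1" using q by auto
  ultimately have "convergent x" by (rule geometric_steps_convergent)
  then obtain xs where xs: "x \<longlonglongrightarrow> xs" by (auto simp: convergent_def)
  have "isCont F xs"
    using assms(1) unfolding continuously_differentiable_def by (blast intro: has_derivative_continuous)
  moreover have "u0 \<delta> F (x k) \<le> ereal (u 0 * q ^ k)" for k using dec[of k] u_le[of k] by simp
  moreover have "(\<lambda>k. u 0 * q ^ k) \<longlonglongrightarrow> 0"
    using q by (intro tendsto_mult_right_zero LIMSEQ_power_zero) simp
  ultimately have "u0 \<delta> F xs \<le> ereal 0" by (rule u0_limit_le[OF xs])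
  then have "pareto_solution F xs"
    unfolding zero_ereal_def[symmetric] by (rule pareto_solution_if_u0_le_0[OF B sc' \<delta> \<delta>])
  with xs show "\<exists>xs. pareto_solution F xs \<and> x \<longlonglongrightarrow> xs" by blast
qed

end
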